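(* Let $P\in\mathfrak{P}_1$, let $f=1+zF\in P$ with $F\in\mathcal{R}_{\mathbb{R}}$, and let $Z=Z(f)$. Put $$\mathcal{F}_Z(P)=\{Z(h): h\in P,\ h=1+zH \text{ with } H\in\mathcal{R}_{\mathbb{R}},\ Z(h)\subseteq Z\}.$$ Then for every partition $Z=Z_1\sqcup Z_2$, at least one of $Z_1,Z_2$ lies in $\mathcal{F}_Z(P)$.
   Context: $\mathbb{D}=\{z\in\mathbb{C}:|z|<1\}$ is the open unit disk and $\mathcal{O}(\mathbb{D})$ is the ring of holomorphic functions on $\mathbb{D}$. $\mathcal{R}_{\mathbb{R}}=\mathbb{Z}[[z]]\cap\mathcal{O}(\mathbb{D})$ is the ring of holomorphic functions on $\mathbb{D}$ all of whose Taylor coefficients at $0$ are integers. $\mathfrak{P}_1$ is the set of prime ideals of $\mathcal{R}_{\mathbb{R}}$ containing at least one element of the form $1+zG$ with $G\in\mathcal{R}_{\mathbb{R}}$. $Z(f)$ denotes the zero set of $f$ in $\mathbb{D}$ counted with multiplicities, regarded as an effective divisor; $Z(h)\subseteq Z$ means containment with multiplicities. A partition $Z=Z_1\sqcup Z_2$ is a decomposition of $Z$ into two effective divisors with disjoint supports whose sum (union with multiplicities) is $Z$.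
   Formalization: The partition is additionally assumed to be invariant under complex conjugation (Z_1, hence also Z_2); otherwise the claim fails, e.g. for f=1+z+2z^2 with its two conjugate zeros separated. *)

theory Defs
  imports "HOL-Complex_Analysis.Complex_Analysis" "HOL-Algebra.Ideal"
begin

abbreviation unit_disk :: "complex set" where
  "unit_disk \<equiv> ball 0 1"

text \<open>A function on the disk is represented by an extensional function, i.e. one that takes a
  fixed junk value off the disk, so that equality in the ring is equality on the disk.\<close>

definition taylor_coeff :: "(complex \<Rightarrow> complex) \<Rightarrow> nat \<Rightarrow> complex" where
  "taylor_coeff f n = (deriv ^^ n) f 0 / fact n"

definition RR :: "(complex \<Rightarrow> complex) ring" where
  "RR = \<lparr>carrier = {f \<in> extensional unit_disk.
                      f holomorphic_on unit_disk \<and> (\<forall>n. taylor_coeff f n \<in> \<int>)},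
         mult = (\<lambda>f g. \<lambda>z\<in>unit_disk. f z * g z),
         one = (\<lambda>z\<in>unit_disk. 1),
         zero = (\<lambda>z\<in>unit_disk. 0),
         add = (\<lambda>f g. \<lambda>z\<in>unit_disk. f z + g z)\<rparr>"

definition one_plus_z :: "(complex \<Rightarrow> complex) \<Rightarrow> complex \<Rightarrow> complex" where
  "one_plus_z F = (\<lambda>z\<in>unit_disk. 1 + z * F z)"

definition PP1 :: "(complex \<Rightarrow> complex) set set" where
  "PP1 = {P. primeideal P RR \<and> (\<exists>G\<in>carrier RR. one_plus_z G \<in> P)}"

definition divisor_support :: "(complex \<Rightarrow> nat) \<Rightarrow> complex set" where
  "divisor_support D = {z. D z \<noteq> 0}"

definition effective_divisor :: "(complex \<Rightarrow> nat) \<Rightarrow> bool" where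
  "effective_divisor D \<longleftrightarrow>
     divisor_support D \<subseteq> unit_disk \<and> divisor_support D sparse_in unit_disk"

text \<open>Only meaningful when \<open>f\<close> is holomorphic on the disk and not identically zero there (otherwise
  \<^const>\<open>zorder\<close> is unspecified); every function of the form \<^term>\<open>one_plus_z F\<close> takes the value 1
  at the origin.\<close>
definition zero_divisor_of :: "(complex \<Rightarrow> complex) \<Rightarrow> complex \<Rightarrow> nat" where
  "zero_divisor_of f z = (if z \<in> unit_disk then nat (zorder f z) else 0)"

definition divisor_partition ::
    "(complex \<Rightarrow> nat) \<Rightarrow> (complex \<Rightarrow> nat) \<Rightarrow> (complex \<Rightarrow> nat) \<Rightarrow> bool" where
  "divisor_partition Z Z1 Z2 \<longleftrightarrow>
     effective_divisor Z1 \<and> effective_divisor Z2 \<and>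
     divisor_support Z1 \<inter> divisor_support Z2 = {} \<and> (\<forall>z. Z z = Z1 z + Z2 z)"

text \<open>Members of the ring have real Taylor coefficients, so their zero divisors are invariant under
  complex conjugation, and a partition of such a divisor has both parts invariant or neither. In
  the latter case neither part has the form \<open>zero_divisor_of h\<close> with \<open>h\<close> in the ring. This does
  happen: \<open>1 + z + 2 * z\<^sup>2\<close> has exactly two zeros in the disk, simple and conjugate to each other.
  Partitions are therefore taken among the conjugation-invariant divisors.\<close>
definition conj_invariant :: "(complex \<Rightarrow> nat) \<Rightarrow> bool" where
  "conj_invariant D \<longleftrightarrow> (\<forall>z. D (cnj z) = D z)"

definition FF :: "(complex \<Rightarrow> nat) \<Rightarrow> (complex \<Rightarrow> complex) set \<Rightarrow> (complex \<Rightarrow> nat) set" where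
  "FF Z P = {zero_divisor_of h | h.
     h \<in> P \<and> (\<exists>H\<in>carrier RR. h = one_plus_z H) \<and> (\<forall>z. zero_divisor_of h z \<le> Z z)}"

end

theory Submission
  imports Defs
begin

text \<open>
  The ideal is prime, so it is enough to factor \<open>f = h\<^sub>1 h\<^sub>2\<close> inside the ring, where \<open>h\<^sub>i\<close> has
  constant term 1 and zero divisor exactly \<open>Z\<^sub>i\<close>: one of the two factors lies in \<open>P\<close>, and its
  divisor is then a member of the family.

  Only \<open>h\<^sub>1\<close> needs a construction. A Weierstrass product for the disk yields a
  holomorphic \<open>g\<^sub>1\<close> with divisor \<open>Z\<^sub>1\<close> and \<open>g\<^sub>1(0) = 1\<close>
  (\<open>disk_function_with_divisor\<close>). As \<open>Z\<^sub>1\<close> is invariant under conjugation, \<open>g\<^sub>1\<close> can be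
  chosen with real Taylor coefficients. These become integers after multiplication by a zero-free
  function \<open>exp q\<close>, \<open>q(z) = \<Sum>t\<^sub>n z\<^sup>n\<close>: the number \<open>t\<^sub>n\<close> enters the \<open>n\<close>-th coefficient of
  \<open>g\<^sub>1 exp q\<close> additively and does not affect the earlier ones, so the \<open>t\<^sub>n\<close> can be chosen
  one after another in \<open>[-1/2, 1/2]\<close> so as to round each coefficient to an integer
  (\<open>integral_exp_twist\<close>). Bounded coefficients make \<open>q\<close> holomorphic on the disk. Put
  \<open>h\<^sub>1 = g\<^sub>1 exp q\<close>.

  The cofactor \<open>h\<^sub>2 = f / h\<^sub>1\<close> is holomorphic because the zeros of \<open>h\<^sub>1\<close> are, with
  multiplicity, among those of \<open>f\<close>, and its coefficients are integers because a power series with integer coefficients and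
  constant term 1 is invertible over the integers (\<open>fps_factor_coeffs_closed\<close>).
\<close>

section \<open>Power series: division and rounding of coefficients\<close>

text \<open>
  Comparing \<open>n\<close>-th coefficients in \<open>A = B * C\<close> expresses the \<open>n\<close>-th coefficient of \<open>C\<close> through
  earlier ones without division, since \<open>B\<close> has constant term 1. The set \<open>S\<close> will be the real
  numbers, for logarithmic derivatives, and the integers, for the cofactor of \<open>f\<close>.
\<close>

lemma fps_factor_coeffs_closed:
  fixes A B C :: "'a::comm_ring_1 fps"
  assumes zero: "0 \<in> S" and diff: "\<And>x y. x \<in> S \<Longrightarrow> y \<in> S \<Longrightarrow> x - y \<in> S"
    and mult: "\<And>x y. x \<in> S \<Longrightarrow> y \<in> S \<Longrightarrow> x * y \<in> S"
    and A: "\<And>n. fps_nth A n \<in> S" and B: "\<And>n. fps_nth B n \<in> S" "fps_nth B 0 = 1"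
    and eq: "A = B * C"
  shows "fps_nth C n \<in> S"
proof (induction n rule: less_induct)
  case (less n)
  have add: "x + y \<in> S" if "x \<in> S" "y \<in> S" for x y
    using diff[OF \<open>x \<in> S\<close> diff[OF zero \<open>y \<in> S\<close>]] by simp
  have sum: "sum g I \<in> S" if "\<And>i. i \<in> I \<Longrightarrow> g i \<in> S" for g and I :: "nat set"
    using that by (induction I rule: infinite_finite_induct) (auto simp: zero add)
  have "fps_nth A n = (\<Sum>i=0..n. fps_nth B i * fps_nth C (n - i))"
    by (simp add: eq fps_mult_nth)
  also have "\<dots> = fps_nth C n + (\<Sum>i=Suc 0..n. fps_nth B i * fps_nth C (n - i))"
    by (subst sum.atLeast_Suc_atMost) (simp_all add: B(2))
  finally have "fps_nth C n = fps_nth A n - (\<Sum>i=Suc 0..n. fps_nth B i * fps_nth C (n - i))"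
    by (simp add: algebra_simps)
  moreover have "(\<Sum>i=Suc 0..n. fps_nth B i * fps_nth C (n - i)) \<in> S"
    by (intro sum mult B(1) less.IH) auto
  ultimately show ?case
    using diff A by metis
qed

text \<open>The quotient of \<open>G\<close> by \<open>H\<close> has derivative 0.\<close>
lemma fps_eq_if_same_log_deriv:
  fixes G H L :: "'a::field_char_0 fps"
  assumes "fps_deriv G = L * G" "fps_deriv H = L * H" "fps_nth G 0 = fps_nth H 0" "fps_nth H 0 \<noteq> 0"
  shows "G = H"
proof -
  have inv: "H * inverse H = 1"
    using assms(4) by (simp add: inverse_mult_eq_1')
  have "fps_deriv (G * inverse H) = L * G * inverse H * (1 - H * inverse H)"
    using assms by (simp add: fps_inverse_deriv power2_eq_square algebra_simps)
  hence "fps_deriv (G * inverse H) = 0"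
    by (simp only: inv) simp
  hence "G * inverse H = fps_const (fps_nth (G * inverse H) 0)"
    by (simp only: fps_deriv_eq_0_iff)
  also have "\<dots> = 1"
    using assms(3,4) by simp
  finally have "G * inverse H * H = H"
    by simp
  thus ?thesis
    by (metis inv mult.assoc mult.commute mult.right_neutral)
qed

text \<open>
  The coefficients \<open>h\<^sub>n\<close> of \<open>H = A * exp T\<close> are governed by the differential equation
  \<open>H' = (L + T') H\<close>, where \<open>L = A' / A\<close> has real coefficients. It reads
  \<open>(m+1) h\<^sub>m\<^sub>+\<^sub>1 = (m+1) t\<^sub>m\<^sub>+\<^sub>1 + X\<^sub>m\<close>, where \<open>X\<^sub>m\<close> is real and involves only the \<open>t\<^sub>k\<close>
  and \<open>h\<^sub>k\<close> with \<open>k \<le> m\<close>. Hence \<open>h\<^sub>m\<^sub>+\<^sub>1\<close> can be taken to be the integer nearest to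
  \<open>X\<^sub>m / (m+1)\<close>, with \<open>t\<^sub>m\<^sub>+\<^sub>1\<close> the rounding error.
\<close>
lemma integral_exp_twist:
  fixes A :: "complex fps"
  assumes A0: "fps_nth A 0 = 1" and real: "\<And>n. fps_nth A n \<in> \<real>"
  obtains T where "fps_nth T 0 = 0" "\<And>n. norm (fps_nth T n) \<le> 1"
    "\<And>n. fps_nth (A * (fps_exp 1 oo T)) n \<in> \<int>"
proof -
  define L where "L = fps_deriv A * inverse A"
  have "A * inverse A = 1"
    using A0 by (simp add: inverse_mult_eq_1')
  hence AL: "fps_deriv A = A * L"
    by (simp add: L_def mult.left_commute)
  have L_real: "fps_nth L n \<in> \<real>" for n
    by (rule fps_factor_coeffs_closed[OF _ _ _ _ real A0 AL])
       (use real in \<open>auto simp del: of_nat_Suc\<close>)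
  define X where "X = (\<lambda>f m. fps_nth L m +
    (\<Sum>k=1..m. (fps_nth L (k - 1) + of_nat k * fst (f k)) * snd (f (Suc m - k))))"
  \<comment> \<open>The pairs chosen recursively are \<open>(t\<^sub>n, h\<^sub>n)\<close>.\<close>
  define good where "good = (\<lambda>(f :: nat \<Rightarrow> complex \<times> complex) n r.
    norm (fst r) \<le> 1 \<and> fst r \<in> \<real> \<and> snd r \<in> \<int> \<and>
    (case n of 0 \<Rightarrow> r = (0, 1)
     | Suc m \<Rightarrow> of_nat (Suc m) * snd r = of_nat (Suc m) * fst r + X f m))"
  have "\<exists>f. \<forall>n. good f n (f n)"
  proof (rule dependent_wf_choice[OF wf], goal_cases)
    case (1 f g n r)
    have "X f m = X g m" if "n = Suc m" for m
      unfolding X_def using that by (intro arg_cong2[where f = "(+)"] refl sum.cong) (auto simp: 1)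
    thus ?case
      by (auto simp: good_def split: nat.splits)
  next
    case (2 n f)
    show ?case
    proof (cases n)
      case 0
      thus ?thesis by (auto simp: good_def)
    next
      case (Suc m)
      have "fst (f k) \<in> \<real>" "snd (f k) \<in> \<real>" if "k < n" for k
        using 2[of k] that by (auto simp: good_def elim!: Ints_cases)
      hence "X f m \<in> \<real>"
        unfolding X_def by (intro Reals_add sum_in_Reals Reals_mult L_real) (auto simp: Suc)
      hence "X f m / of_nat (Suc m) \<in> \<real>"
        by (intro Reals_divide) auto
      then obtain x where x: "X f m / of_nat (Suc m) = of_real x"
        by (auto elim: Reals_cases)
      hence x': "X f m = of_nat (Suc m) * of_real x"
        by (simp add: field_simps del: of_nat_Suc)
      have "\<bar>of_int (round x) - x\<bar> \<le> 1 / 2"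
        by (rule of_int_round_abs_le)
      hence "norm (complex_of_real (of_int (round x) - x)) \<le> 1"
        unfolding norm_of_real by linarith
      hence "good f n (of_real (of_int (round x) - x), of_int (round x))"
        by (simp add: good_def Suc x' algebra_simps del: of_nat_Suc)
      thus ?thesis ..
    qed
  qed
  then obtain f where f: "\<And>n. good f n (f n)" by blast
  define T where "T = Abs_fps (\<lambda>n. fst (f n))"
  define H where "H = Abs_fps (\<lambda>n. snd (f n))"
  define E where "E = fps_exp 1 oo T"
  have f0: "f 0 = (0, 1)"
    using f[of 0] by (simp add: good_def)
  have T0: "fps_nth T 0 = 0"
    by (simp add: T_def f0)
  have "fps_deriv (A * E) = (L + fps_deriv T) * (A * E)"
    using T0 by (simp add: E_def fps_compose_deriv AL algebra_simps)
  moreover have "fps_deriv H = (L + fps_deriv T) * H"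
  proof (rule fps_ext)
    fix m
    have "fps_nth ((L + fps_deriv T) * H) m =
      (\<Sum>k=0..m. (fps_nth L k + of_nat (Suc k) * fst (f (Suc k))) * snd (f (m - k)))"
      by (simp add: fps_mult_nth H_def T_def del: of_nat_Suc)
    also have "\<dots> = (\<Sum>k=1..Suc m. (fps_nth L (k - 1) + of_nat k * fst (f k)) * snd (f (Suc m - k)))"
      by (rule sum.reindex_bij_witness[of _ "\<lambda>k. k - 1" Suc]) auto
    also have "\<dots> = of_nat (Suc m) * fst (f (Suc m)) + X f m"
      by (simp add: X_def f0 algebra_simps)
    also have "\<dots> = of_nat (Suc m) * snd (f (Suc m))"
      using f[of "Suc m"] by (simp add: good_def del: of_nat_Suc)
    finally show "fps_nth (fps_deriv H) m = fps_nth ((L + fps_deriv T) * H) m"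
      by (simp add: H_def del: of_nat_Suc)
  qed
  moreover have "fps_nth (A * E) 0 = fps_nth H 0" "fps_nth H 0 \<noteq> 0"
    by (simp_all add: E_def A0 H_def f0)
  ultimately have "A * E = H"
    by (rule fps_eq_if_same_log_deriv)
  thus ?thesis
    using f by (intro that[of T] T0) (auto simp: T_def H_def E_def good_def)
qed


section \<open>Weierstrass products on the disk\<close>

text \<open>
  The logarithm of the elementary factor of index \<open>n\<close> is minus the tail of the series of
  \<open>- Ln (1 - w)\<close>, so on \<open>\<bar>w\<bar> \<le> \<rho>\<close> its modulus is at most \<open>\<rho>\<^sup>n\<^sup>+\<^sup>1 / (1 - \<rho>)\<close>. The bound
  \<open>weierstrass_factor_bound\<close>, made for products over the whole plane, covers only
  \<open>\<bar>w\<bar> \<le> 1/2\<close>; zeros near the unit circle need every \<open>\<rho> < 1\<close>.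
\<close>
lemma weierstrass_factor_uniform_limit:
  assumes "\<rho> < 1"
  shows "uniform_limit (cball 0 \<rho>) weierstrass_factor (\<lambda>_. 1) sequentially"
proof (cases "\<rho> < 0")
  case True
  thus ?thesis by simp
next
  case False
  have "uniform_limit (cball 0 \<rho>) (\<lambda>n w. weierstrass_factor n w - 1) (\<lambda>_. 0) sequentially"
  proof (rule uniform_limit_null_comparison)
    have "(\<lambda>n. \<rho> ^ Suc n / (1 - \<rho>)) \<longlonglongrightarrow> 0 / (1 - \<rho>)"
      using assms False by (intro tendsto_divide LIMSEQ_Suc[OF LIMSEQ_power_zero] tendsto_const) auto
    hence tend: "(\<lambda>n. \<rho> ^ Suc n / (1 - \<rho>)) \<longlonglongrightarrow> 0" by simp
    have bound: "norm (weierstrass_factor n w - 1) \<le> 3 / 2 * (\<rho> ^ Suc n / (1 - \<rho>))"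
      if w: "norm w \<le> \<rho>" and small: "\<rho> ^ Suc n / (1 - \<rho>) < 1 / 2" for n w
    proof -
      have "(\<lambda>k. w ^ k / of_nat k) sums - Ln (1 - w)"
        using sums_minus[OF Ln_series[of "-w"]] w assms by (simp add: power_minus')
      hence "(\<lambda>k. w ^ (k + Suc n) / of_nat (k + Suc n)) sums
               (- Ln (1 - w) - (\<Sum>k<Suc n. w ^ k / of_nat k))"
        by (intro sums_split_initial_segment)
      also have "(\<Sum>k<Suc n. w ^ k / of_nat k) = (\<Sum>k=1..n. w ^ k / of_nat k)"
        by (intro sum.mono_neutral_right) auto
      finally have "- Ln (1 - w) - (\<Sum>k=1..n. w ^ k / of_nat k) =
          (\<Sum>k. w ^ (k + Suc n) / of_nat (k + Suc n))"
        by (simp add: sums_iff)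
      moreover have "norm (\<Sum>k. w ^ (k + Suc n) / of_nat (k + Suc n)) \<le> (\<Sum>k. \<rho> ^ Suc n * \<rho> ^ k)"
      proof (rule norm_suminf_le)
        fix k
        have "norm (w ^ (k + Suc n) / of_nat (k + Suc n)) \<le> norm w ^ (k + Suc n) / 1"
          unfolding norm_divide norm_power norm_of_nat by (intro divide_left_mono) auto
        also have "\<dots> \<le> \<rho> ^ Suc n * \<rho> ^ k"
          using power_mono[OF w, of "k + Suc n"] by (simp add: power_add mult_ac)
        finally show "norm (w ^ (k + Suc n) / of_nat (k + Suc n)) \<le> \<rho> ^ Suc n * \<rho> ^ k" .
      qed (use assms False in \<open>auto intro!: summable_mult summable_geometric\<close>)
      moreover have "(\<Sum>k. \<rho> ^ Suc n * \<rho> ^ k) = \<rho> ^ Suc n / (1 - \<rho>)"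
        using assms False by (subst suminf_mult) (auto simp: suminf_geometric)
      ultimately have norm_le: "norm (Ln (1 - w) + (\<Sum>k=1..n. w ^ k / of_nat k)) \<le> \<rho> ^ Suc n / (1 - \<rho>)"
        by (metis minus_diff_eq diff_minus_eq_add norm_minus_cancel add.commute)
      have "weierstrass_factor n w = exp (Ln (1 - w) + (\<Sum>k=1..n. w ^ k / of_nat k))"
        using w assms by (subst exp_add, subst exp_Ln) (auto simp: weierstrass_factor_def)
      also have "norm (\<dots> - 1) \<le> 3 / 2 * norm (Ln (1 - w) + (\<Sum>k=1..n. w ^ k / of_nat k))"
        by (intro norm_exp_bounds) (use norm_le small in linarith)
      finally show ?thesis
        using norm_le by linarith
    qed
    have "eventually (\<lambda>n. \<rho> ^ Suc n / (1 - \<rho>) < 1 / 2) sequentially"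
      using tend by (rule order_tendstoD) auto
    thus "eventually (\<lambda>n. \<forall>w\<in>cball 0 \<rho>. norm (weierstrass_factor n w - 1) \<le>
            3 / 2 * (\<rho> ^ Suc n / (1 - \<rho>))) sequentially"
      by eventually_elim (use bound in auto)
    show "uniform_limit (cball 0 \<rho>) (\<lambda>n w. 3 / 2 * (\<rho> ^ Suc n / (1 - \<rho>))) (\<lambda>_. 0) sequentially"
      using tendsto_mult_right_zero[OF tend, of "3 / 2"] unfolding uniform_limit_iff tendsto_iff
      by (fast elim: eventually_mono)
  qed
  hence "uniform_limit (cball 0 \<rho>) (\<lambda>n w. (weierstrass_factor n w - 1) + 1) (\<lambda>_. 0 + 1) sequentially"
    by (intro uniform_limit_intros)
  thus ?thesis by simp
qed

text \<open>
  The zeros are treated in finite blocks \<open>A\<close> with a common index \<open>m\<close>, not one at a time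
  in a sequence. If \<open>A\<close> and \<open>D\<close> are invariant under conjugation, the product is then
  conjugation-symmetric as it stands.
\<close>
definition weierstrass_block :: "(complex \<Rightarrow> nat) \<Rightarrow> complex set \<Rightarrow> nat \<Rightarrow> complex \<Rightarrow> complex" where
  "weierstrass_block D A m z = (\<Prod>a\<in>A. weierstrass_factor m (z / a) ^ D a)"

text \<open>
  The zeros in a finite set outside a closed disk have a positive distance to it, so
  \<open>z / a\<close> stays in a disk of radius less than 1. A single large index thus brings the whole
  product as close to 1 as desired on that disk.
\<close>
lemma uniform_limit_weierstrass_block:
  assumes "finite A" "\<And>a. a \<in> A \<Longrightarrow> r < norm a"
  shows "uniform_limit (cball 0 r) (weierstrass_block D A) (\<lambda>_. 1) sequentially"
  unfolding weierstrass_block_def [abs_def] using assms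
proof (induction A rule: finite_induct)
  case empty
  show ?case by (simp add: uniform_limit_const)
next
  case (insert a A)
  show ?case
  proof (cases "r < 0")
    case True
    thus ?thesis by simp
  next
    case False
    have "uniform_limit (cball 0 (r / norm a)) weierstrass_factor (\<lambda>_. 1) sequentially"
      using insert.prems[of a] False by (intro weierstrass_factor_uniform_limit) (auto simp: divide_less_eq)
    hence "uniform_limit (cball 0 r) (\<lambda>m z. weierstrass_factor m (z / a)) (\<lambda>_. 1) sequentially"
      by (rule uniform_limit_compose') (auto simp: norm_divide divide_right_mono)
    hence "uniform_limit (cball 0 r) (\<lambda>m z. weierstrass_factor m (z / a) ^ k) (\<lambda>_. 1) sequentially" for k
    proof (induction k)
      case (Suc k)
      thus ?case
        using uniform_lim_mult[OF Suc.prems Suc.IH[OF Suc.prems]] by (simp add: image_constant_conv)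
    qed (simp add: uniform_limit_const)
    from uniform_lim_mult[OF this[of "D a"] insert.IH] show ?thesis
      using insert by (simp add: image_constant_conv)
  qed
qed

lemma weierstrass_block_holomorphic:
  "0 \<notin> A \<Longrightarrow> weierstrass_block D A m holomorphic_on X"
  unfolding weierstrass_block_def by (intro holomorphic_intros) auto

lemma weierstrass_block_at_0: "weierstrass_block D A m 0 = 1"
  by (simp add: weierstrass_block_def)

lemma weierstrass_block_eq_0_iff:
  assumes "finite A" "0 \<notin> A" "\<And>a. a \<in> A \<Longrightarrow> D a \<noteq> 0"
  shows "weierstrass_block D A m z = 0 \<longleftrightarrow> z \<in> A"
  using assms by (auto simp: weierstrass_block_def)

lemma zorder_weierstrass_factor_scaled:
  assumes "a \<noteq> 0"
  shows "zorder (\<lambda>w. weierstrass_factor m (w / a)) z = (if z = a then 1 else 0)"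
proof (cases "z = a")
  case True
  have "zorder (\<lambda>w. weierstrass_factor m (1 / a * w)) z = zorder (weierstrass_factor m) (1 / a * z)"
    using assms eventually_neq_at_within[of 1 "z / a" UNIV]
    by (intro zorder_scale analytic_on_imp_meromorphic_on analytic_intros) auto
  thus ?thesis
    using assms True by simp
next
  case False
  thus ?thesis
    using assms by (auto intro!: zorder_eq_0I analytic_intros)
qed

lemma zorder_weierstrass_block:
  assumes "finite A" "0 \<notin> A"
  shows "zorder (weierstrass_block D A m) z = (if z \<in> A then int (D z) else 0)"
proof -
  have ev: "eventually (\<lambda>w. w \<notin> A) (at z)"
    using islimpt_finite[OF assms(1)] by (simp add: islimpt_iff_eventually)
  have "zorder (weierstrass_block D A m) z = (\<Sum>a\<in>A. zorder (\<lambda>w. weierstrass_factor m (w / a) ^ D a) z)"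
    unfolding weierstrass_block_def
  proof (rule zorder_prod_analytic)
    show "(\<lambda>w. weierstrass_factor m (w / a) ^ D a) analytic_on {z}" if "a \<in> A" for a
      using that assms by (intro analytic_intros) auto
    show "eventually (\<lambda>w. (\<Prod>a\<in>A. weierstrass_factor m (w / a) ^ D a) \<noteq> 0) (at z)"
      using ev by eventually_elim (use assms in auto)
  qed
  also have "\<dots> = (\<Sum>a\<in>A. if z = a then int (D a) else 0)"
  proof (rule sum.cong[OF refl])
    fix a assume "a \<in> A"
    hence "a \<noteq> 0" using assms by auto
    have "eventually (\<lambda>w. w \<noteq> a) (at z)"
      using ev by eventually_elim (use \<open>a \<in> A\<close> in auto)
    hence "eventually (\<lambda>w. weierstrass_factor m (w / a) \<noteq> 0) (at z)"
      by eventually_elim (use \<open>a \<noteq> 0\<close> in auto)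
    hence "zorder (\<lambda>w. weierstrass_factor m (w / a) ^ D a) z =
        int (D a) * zorder (\<lambda>w. weierstrass_factor m (w / a)) z"
      using \<open>a \<noteq> 0\<close>
      by (intro zorder_power analytic_on_imp_meromorphic_on analytic_intros eventually_frequently) auto
    thus "zorder (\<lambda>w. weierstrass_factor m (w / a) ^ D a) z = (if z = a then int (D a) else 0)"
      using \<open>a \<noteq> 0\<close> by (simp add: zorder_weierstrass_factor_scaled)
  qed
  also have "\<dots> = (if z \<in> A then int (D z) else 0)"
    using assms(1) by (simp add: sum.delta')
  finally show ?thesis .
qed

lemma weierstrass_block_cnj:
  assumes "\<And>a. cnj a \<in> A \<longleftrightarrow> a \<in> A" "\<And>a. D (cnj a) = D a"
  shows "weierstrass_block D A m (cnj z) = cnj (weierstrass_block D A m z)"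
proof -
  have factor: "weierstrass_factor m (cnj w) = cnj (weierstrass_factor m w)" for w
    by (simp add: weierstrass_factor_def exp_cnj)
  have "cnj (weierstrass_block D A m z) = (\<Prod>a\<in>A. weierstrass_factor m (cnj z / cnj a) ^ D a)"
    by (simp add: weierstrass_block_def flip: factor)
  also have "\<dots> = weierstrass_block D A m (cnj z)"
    unfolding weierstrass_block_def
    by (rule prod.reindex_bij_witness[of _ cnj cnj]) (auto simp: assms)
  finally show ?thesis ..
qed

text \<open>
  The factors are close to 1 only on disks growing with \<open>n\<close>. Every compact part of the unit disk
  lies in all but finitely many of them, which is enough for locally uniform convergence.
\<close>
lemma
  fixes B :: "nat \<Rightarrow> complex \<Rightarrow> complex" and r :: "nat \<Rightarrow> real"
  assumes hol: "\<And>n. B n holomorphic_on unit_disk"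
    and r: "incseq r" "r \<longlonglongrightarrow> 1"
    and bound: "\<And>n z. z \<in> unit_disk \<Longrightarrow> norm z \<le> r n \<Longrightarrow> norm (B n z - 1) \<le> (1 / 2) ^ n"
  shows convergent_prod_on_disk: "z \<in> unit_disk \<Longrightarrow> convergent_prod (\<lambda>n. B n z)"
    and holomorphic_prodinf_on_disk: "(\<lambda>z. \<Prod>n. B n z) holomorphic_on unit_disk"
proof -
  have close: "eventually (\<lambda>n. \<forall>z\<in>cball 0 R. norm (norm (B n z - 1)) \<le> (1 / 2) ^ n) sequentially"
    if "R < 1" for R
    using order_tendstoD(1)[OF r(2) that]
    by eventually_elim (use bound that in force)
  have conv: "convergent_prod (\<lambda>n. B n z)" if "z \<in> unit_disk" for z
  proof (rule abs_convergent_prod_imp_convergent_prod)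
    have "eventually (\<lambda>n. norm (norm (B n z - 1)) \<le> (1 / 2) ^ n) sequentially"
      using close[of "norm z"] that by (auto elim: eventually_mono)
    moreover have "summable (\<lambda>n. (1 / 2) ^ n :: real)"
      by (intro summable_geometric) auto
    ultimately show "abs_convergent_prod (\<lambda>n. B n z)"
      unfolding abs_convergent_prod_conv_summable by (rule summable_comparison_test_ev)
  qed
  thus "z \<in> unit_disk \<Longrightarrow> convergent_prod (\<lambda>n. B n z)" for z .
  have lim: "(\<lambda>N. \<Prod>n<N. B n z) \<longlonglongrightarrow> (\<Prod>n. B n z)" if "z \<in> unit_disk" for z
    using convergent_prod_LIMSEQ[OF conv[OF that]] 
    unfolding lessThan_Suc_atMost[symmetric] by (rule LIMSEQ_imp_Suc)
  have unif: "uniform_limit (cball 0 R) (\<lambda>N z. \<Prod>n<N. B n z) (\<lambda>z. \<Prod>n. B n z) sequentially"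
    if "R < 1" for R
  proof -
    have sub: "cball 0 R \<subseteq> unit_disk" using that by auto
    have "uniformly_convergent_on (cball 0 R) (\<lambda>N z. \<Prod>n<N. B n z)"
    proof (rule uniformly_convergent_on_prod')
      show "continuous_on (cball 0 R) (B n)" for n
        using hol sub by (meson continuous_on_subset holomorphic_on_imp_continuous_on)
      show "uniformly_convergent_on (cball 0 R) (\<lambda>N z. \<Sum>n<N. norm (B n z - 1))"
        by (rule Weierstrass_m_test'_ev[OF close[OF that]]) (auto intro!: summable_geometric)
    qed auto
    then obtain g where g: "uniform_limit (cball 0 R) (\<lambda>N z. \<Prod>n<N. B n z) g sequentially"
      by (auto simp: uniformly_convergent_on_def)
    have "g z = (\<Prod>n. B n z)" if "z \<in> cball 0 R" for z
      using tendsto_uniform_limitI[OF g that] lim sub that by (blast intro: LIMSEQ_unique)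
    hence "uniform_limit (cball 0 R) (\<lambda>N z. \<Prod>n<N. B n z) g sequentially \<longleftrightarrow>
        uniform_limit (cball 0 R) (\<lambda>N z. \<Prod>n<N. B n z) (\<lambda>z. \<Prod>n. B n z) sequentially"
      by (intro uniform_limit_cong' refl)
    with g show ?thesis by simp
  qed
  show "(\<lambda>z. \<Prod>n. B n z) holomorphic_on unit_disk"
  proof (rule holomorphic_uniform_sequence[where f = "\<lambda>N z. \<Prod>n<N. B n z"])
    fix z :: complex assume z: "z \<in> unit_disk"
    define d where "d = (1 - norm z) / 2"
    have sub: "cball z d \<subseteq> cball 0 (norm z + d)"
      by (simp add: cball_subset_cball_iff)
    have d: "d > 0" "norm z + d < 1"
      using z by (auto simp: d_def field_simps)
    have "cball z d \<subseteq> unit_disk"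
      using sub d(2) by auto
    thus "\<exists>d>0. cball z d \<subseteq> unit_disk \<and>
        uniform_limit (cball z d) (\<lambda>N z. \<Prod>n<N. B n z) (\<lambda>z. \<Prod>n. B n z) sequentially"
      using uniform_limit_on_subset[OF unif[OF d(2)] sub] d(1) by blast
  qed (use hol in \<open>auto intro!: holomorphic_on_prod\<close>)
qed

text \<open>
  The support is cut into the shells \<open>r\<^sub>n < \<bar>a\<bar> \<le> r\<^sub>n\<^sub>+\<^sub>1\<close> with \<open>r\<^sub>n = 1 - 1/(n+1)\<close>, each of which
  is finite because the support is sparse in the disk. The block of the \<open>n\<close>-th
  shell is given an index that brings it within \<open>2\<^sup>-\<^sup>n\<close> of 1 on \<open>\<bar>z\<bar> \<le> r\<^sub>n\<close>, so that the product
  of the blocks converges. Near a given point only finitely many blocks have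
  zeros, and the others multiply to a function that is holomorphic and nonzero there; so the
  orders can be read off from a finite product.
\<close>
theorem disk_function_with_divisor:
  assumes eff: "effective_divisor D" and D0: "D 0 = 0"
  obtains g where "g holomorphic_on unit_disk" "g 0 = 1"
    "\<And>z. z \<in> unit_disk \<Longrightarrow> g z = 0 \<longleftrightarrow> D z \<noteq> 0"
    "\<And>z. z \<in> unit_disk \<Longrightarrow> zorder g z = int (D z)"
    "\<And>z. conj_invariant D \<Longrightarrow> z \<in> unit_disk \<Longrightarrow> g (cnj z) = cnj (g z)"
proof -
  define r :: "nat \<Rightarrow> real" where "r = (\<lambda>n. 1 - inverse (real (Suc n)))"
  have r_lim: "r \<longlonglongrightarrow> 1"
    unfolding r_def by (rule tendsto_eq_intros LIMSEQ_inverse_real_of_nat refl)+ simp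
  have r_mono: "r m \<le> r n" if "m \<le> n" for m n
    unfolding r_def using that by (intro diff_mono le_imp_inverse_le) auto
  have r_less: "r n < 1" for n
    by (simp add: r_def)
  have r0: "r 0 = 0"
    by (simp add: r_def)

  define A where "A = (\<lambda>n. {a. D a \<noteq> 0 \<and> r n < norm a \<and> norm a \<le> r (Suc n)})"
  have finA: "finite (A n)" for n
  proof (rule finite_subset)
    show "A n \<subseteq> cball 0 (r (Suc n)) \<inter> divisor_support D"
      by (auto simp: A_def divisor_support_def)
    have "divisor_support D sparse_in cball 0 (r (Suc n))"
      using eff r_less[of "Suc n"]
      by (auto simp: effective_divisor_def intro: sparse_in_subset)
    thus "finite (cball 0 (r (Suc n)) \<inter> divisor_support D)"
      by (intro sparse_in_compact_finite) auto
  qed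
  have A0: "0 \<notin> A n" for n
    by (simp add: A_def D0)
  have shell: "\<exists>k. \<forall>n. z \<in> A n \<longleftrightarrow> n = k" if z: "z \<in> unit_disk" "D z \<noteq> 0" for z
  proof -
    have "eventually (\<lambda>n. norm z < r (Suc n)) sequentially"
      using z LIMSEQ_Suc[OF r_lim] by (intro order_tendstoD(1)) auto
    then obtain n where "norm z < r (Suc n)"
      by (auto simp: eventually_sequentially)
    hence ex: "norm z \<le> r (Suc n)" by simp
    define k where "k = (LEAST n. norm z \<le> r (Suc n))"
    have k: "norm z \<le> r (Suc k)"
      unfolding k_def using ex by (rule LeastI)
    have "r n < norm z" if "n \<le> k" for n
    proof (cases n)
      case 0
      thus ?thesis using z(2) D0 r0 by auto
    next
      case (Suc l)
      hence "l < k" using that by simp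
      thus ?thesis
        using not_less_Least[of l "\<lambda>n. norm z \<le> r (Suc n)"] Suc by (simp add: k_def)
    qed
    hence "\<not> norm z \<le> r (Suc n)" if "n < k" for n
      using that by (simp add: not_le Suc_le_eq)
    moreover have "\<not> r n < norm z" if "k < n" for n
      using k r_mono[of "Suc k" n] that by simp
    moreover have "z \<in> A k"
      using k \<open>\<And>n. n \<le> k \<Longrightarrow> r n < norm z\<close> z(2) by (simp add: A_def)
    ultimately have "z \<in> A n \<longleftrightarrow> n = k" for n
      by (cases n k rule: linorder_cases) (auto simp: A_def)
    thus ?thesis by blast
  qed

  have "\<exists>m. \<forall>z\<in>cball 0 (r n). norm (weierstrass_block D (A n) m z - 1) \<le> (1 / 2) ^ n" for n
  proof -
    have "uniform_limit (cball 0 (r n)) (weierstrass_block D (A n)) (\<lambda>_. 1) sequentially"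
      using finA[of n]
      by (rule uniform_limit_weierstrass_block) (simp add: A_def)
    hence "eventually (\<lambda>m. \<forall>z\<in>cball 0 (r n). dist (weierstrass_block D (A n) m z) 1 < (1 / 2) ^ n) sequentially"
      by (rule uniform_limitD) simp
    hence "\<exists>m. \<forall>z\<in>cball 0 (r n). dist (weierstrass_block D (A n) m z) 1 < (1 / 2) ^ n"
      unfolding eventually_sequentially by blast
    thus ?thesis
      unfolding dist_norm using less_imp_le by blast
  qed
  then obtain m where m: "\<And>n z. norm z \<le> r n \<Longrightarrow>
      norm (weierstrass_block D (A n) (m n) z - 1) \<le> (1 / 2) ^ n"
    by (metis mem_cball_0)
  define B where "B = (\<lambda>n. weierstrass_block D (A n) (m n))"
  define g where "g = (\<lambda>z. \<Prod>n. B n z)"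

  have hol: "B n holomorphic_on X" for n X
    unfolding B_def using A0 by (rule weierstrass_block_holomorphic)
  have zero: "B n z = 0 \<longleftrightarrow> z \<in> A n" for n z
    unfolding B_def using finA A0 by (rule weierstrass_block_eq_0_iff) (simp add: A_def)
  have ord: "zorder (B n) z = (if z \<in> A n then int (D z) else 0)" for n z
    unfolding B_def using finA A0 by (rule zorder_weierstrass_block)
  have bound: "norm (B (n + N) z - 1) \<le> (1 / 2) ^ n" if "norm z \<le> r (n + N)" for n N z
  proof -
    have "norm (B (n + N) z - 1) \<le> (1 / 2) ^ (n + N)"
      using m[OF that] by (simp add: B_def)
    also have "\<dots> \<le> (1 / 2) ^ n"
      by (intro power_decreasing) auto
    finally show ?thesis .
  qed
  have incseq: "incseq (\<lambda>n. r (n + N))" and lim: "(\<lambda>n. r (n + N)) \<longlonglongrightarrow> 1" for N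
    using r_mono LIMSEQ_ignore_initial_segment[OF r_lim] by (auto simp: incseq_def)
  have conv: "convergent_prod (\<lambda>n. B (n + N) z)" if "z \<in> unit_disk" for z N
    using hol incseq[of N] lim[of N] bound that
    by (rule convergent_prod_on_disk[where B = "\<lambda>n. B (n + N)" and r = "\<lambda>n. r (n + N)"])
  have tail_hol: "(\<lambda>z. \<Prod>n. B (n + N) z) holomorphic_on unit_disk" for N
    using hol incseq[of N] lim[of N] bound
    by (rule holomorphic_prodinf_on_disk[where B = "\<lambda>n. B (n + N)" and r = "\<lambda>n. r (n + N)"])

  have g_zero: "g z = 0 \<longleftrightarrow> D z \<noteq> 0" if z: "z \<in> unit_disk" for z
  proof -
    have "(\<lambda>n. B n z) has_prod g z"
      using conv[of z 0] z by (auto simp: g_def)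
    hence "g z = 0 \<longleftrightarrow> (\<exists>n. z \<in> A n)"
      by (subst has_prod_eq_0_iff) (auto simp: image_iff eq_commute[of 0] zero)
    also have "\<dots> \<longleftrightarrow> D z \<noteq> 0"
      using shell[OF z] by (auto simp: A_def)
    finally show ?thesis .
  qed
  have g_hol: "g holomorphic_on unit_disk"
    using tail_hol[of 0] by (simp add: g_def)

  show ?thesis
  proof
    show "g holomorphic_on unit_disk" by fact
    show "g 0 = 1"
      by (simp add: g_def B_def weierstrass_block_at_0)
    show "g z = 0 \<longleftrightarrow> D z \<noteq> 0" if "z \<in> unit_disk" for z
      using that by (rule g_zero)
  next
    fix z assume z: "z \<in> unit_disk"
    have "eventually (\<lambda>n. norm z < r n) sequentially"
      using z r_lim by (intro order_tendstoD(1)) auto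
    then obtain N where N: "norm z < r N"
      by (auto simp: eventually_sequentially)
    define T where "T = (\<lambda>w. \<Prod>n. B (n + N) w)"
    have split: "g w = (\<Prod>n<N. B n w) * T w" if "w \<in> unit_disk" for w
      using has_prod_unique2[OF _ has_prod_ignore_initial_segment'[OF conv[of w 0]], of "g w" N]
        conv[of w 0] that by (auto simp: g_def T_def)
    have out: "z \<notin> A n" if "N \<le> n" for n
      using r_mono[OF that] N by (auto simp: A_def)
    have "T z \<noteq> 0"
      unfolding T_def using conv[of z N] z
      by (intro prodinf_nonzero) (auto simp: zero out)
    have ana_T: "T analytic_on {z}"
      using tail_hol[of N] z unfolding T_def[symmetric] analytic_at by (intro exI[of _ unit_disk]) auto
    have B_ana: "B n analytic_on {z}" for n
      using hol[of n UNIV] analytic_at by blast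
    have ana_P: "(\<lambda>w. \<Prod>n<N. B n w) analytic_on {z}"
      by (intro analytic_intros B_ana)
    have "eventually (\<lambda>w. w \<in> unit_disk) (at z)"
      using z by (intro eventually_at_in_open') auto
    moreover have "eventually (\<lambda>w. w \<notin> divisor_support D) (at z)"
      using eff z by (auto simp: effective_divisor_def sparse_in_def islimpt_iff_eventually)
    ultimately have nz: "eventually (\<lambda>w. (\<Prod>n<N. B n w) * T w \<noteq> 0) (at z)"
      by eventually_elim (use g_zero in \<open>auto simp flip: split simp: divisor_support_def\<close>)
    have "zorder g z = zorder (\<lambda>w. (\<Prod>n<N. B n w) * T w) z"
      by (rule zorder_cong) (use \<open>eventually (\<lambda>w. w \<in> unit_disk) (at z)\<close> in
        \<open>auto elim!: eventually_mono simp: split\<close>)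
    also have "\<dots> = zorder (\<lambda>w. \<Prod>n<N. B n w) z"
      using zorder_times_analytic[OF ana_P ana_T nz] zorder_eq_0I[OF ana_T \<open>T z \<noteq> 0\<close>] by simp
    also have "\<dots> = (\<Sum>n<N. zorder (B n) z)"
    proof (rule zorder_prod_analytic)
      show "eventually (\<lambda>w. (\<Prod>n<N. B n w) \<noteq> 0) (at z)"
        using nz by eventually_elim auto
    qed (rule B_ana)
    also have "\<dots> = (\<Sum>n<N. if z \<in> A n then int (D z) else 0)"
      by (simp add: ord)
    also have "\<dots> = int (D z)"
    proof (cases "D z = 0")
      case False
      then obtain k where k: "\<And>n. z \<in> A n \<longleftrightarrow> n = k"
        using shell z by blast
      have "k < N"
        using out[of k] k[of k] by (meson not_le)
      thus ?thesis by (simp add: k)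
    qed (auto intro: sum.neutral)
    finally show "zorder g z = int (D z)" .
  next
    fix z assume conj: "conj_invariant D" and z: "z \<in> unit_disk"
    have "B n (cnj w) = cnj (B n w)" for n w
      unfolding B_def using conj by (intro weierstrass_block_cnj) (auto simp: A_def conj_invariant_def)
    hence "(\<lambda>N. \<Prod>n\<le>N. B n (cnj z)) = (\<lambda>N. cnj (\<Prod>n\<le>N. B n z))"
      by simp
    moreover have "(\<lambda>N. cnj (\<Prod>n\<le>N. B n z)) \<longlonglongrightarrow> cnj (g z)"
      using convergent_prod_LIMSEQ[OF conv[of z 0]] z by (intro tendsto_cnj) (simp add: g_def)
    moreover have "(\<lambda>N. \<Prod>n\<le>N. B n (cnj z)) \<longlonglongrightarrow> g (cnj z)"
      using convergent_prod_LIMSEQ[OF conv[of "cnj z" 0]] z by (simp add: g_def)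
    ultimately show "g (cnj z) = cnj (g z)"
      using LIMSEQ_unique by metis
  qed
qed


section \<open>Functions on the disk with real or integer Taylor coefficients\<close>

text \<open>The function \<open>cnj (f (cnj z))\<close> has the conjugated Taylor coefficients.\<close>
lemma real_coeffs_if_cnj_symmetric:
  assumes hol: "f holomorphic_on unit_disk"
    and sym: "\<And>z. z \<in> unit_disk \<Longrightarrow> f (cnj z) = cnj (f z)"
    and F: "f has_fps_expansion F"
  shows "fps_nth F n \<in> \<real>"
proof -
  define G where "G = Abs_fps (\<lambda>n. cnj (fps_nth F n))"
  have radius: "fps_conv_radius G = fps_conv_radius F"
    by (simp add: G_def fps_conv_radius_def conv_radius_def)
  have "eval_fps G z = f z" if z: "z \<in> unit_disk" for z
  proof -
    have "(\<lambda>n. fps_nth F n * cnj z ^ n) sums f (cnj z)"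
      using F hol z by (intro has_fps_expansion_imp_sums_complex[where r = 1]) auto
    hence "(\<lambda>n. cnj (fps_nth F n * cnj z ^ n)) sums cnj (f (cnj z))"
      by (simp only: sums_cnj)
    thus ?thesis
      using sym[OF z] by (simp add: eval_fps_def G_def sums_iff)
  qed
  hence "eventually (\<lambda>z. eval_fps G z = f z) (nhds 0)"
    using eventually_nhds_in_open[of unit_disk 0] by (auto elim: eventually_mono)
  hence "f has_fps_expansion G"
    using F radius by (auto simp: has_fps_expansion_def)
  hence "F = G"
    using F fps_expansion_unique_complex by blast
  hence "cnj (fps_nth F n) = fps_nth F n"
    by (metis G_def fps_nth_Abs_fps)
  thus ?thesis
    by (simp add: Reals_cnj_iff)
qed

lemma unit_disk_subset_eball:
  assumes "R \<ge> 1"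
  shows "unit_disk \<subseteq> eball 0 R"
proof
  fix z :: complex assume "z \<in> unit_disk"
  hence "ereal (norm z) < 1" by simp
  also note assms
  finally show "z \<in> eball 0 R" by (simp add: in_eball_iff)
qed

lemma integral_coeffs_after_exp_twist:
  assumes hol: "g holomorphic_on unit_disk" and g0: "g 0 = 1"
    and sym: "\<And>z. z \<in> unit_disk \<Longrightarrow> g (cnj z) = cnj (g z)"
  obtains q U where "q holomorphic_on unit_disk" "q 0 = 0"
    "(\<lambda>z. g z * exp (q z)) has_fps_expansion U" "\<And>n. fps_nth U n \<in> \<int>"
proof -
  define A where "A = fps_expansion g 0"
  have A: "g has_fps_expansion A"
    unfolding A_def using hol by (intro has_fps_expansion_fps_expansion[of unit_disk]) auto
  have A0: "fps_nth A 0 = 1"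
    using g0 by (simp add: A_def fps_expansion_def)
  have A_real: "fps_nth A n \<in> \<real>" for n
    using hol sym A by (rule real_coeffs_if_cnj_symmetric)
  obtain T where T: "fps_nth T 0 = 0" "\<And>n. norm (fps_nth T n) \<le> 1"
    "\<And>n. fps_nth (A * (fps_exp 1 oo T)) n \<in> \<int>"
    using integral_exp_twist[OF A0 A_real] by metis
  have radius: "fps_conv_radius T \<ge> 1"
    unfolding fps_conv_radius_def
  proof (rule conv_radius_geI_ex')
    fix r :: real assume r: "0 < r" "ereal r < 1"
    show "summable (\<lambda>n. fps_nth T n * of_real r ^ n)"
    proof (rule summable_comparison_test)
      have "norm (fps_nth T n * of_real r ^ n) \<le> r ^ n" for n
        using mult_right_mono[OF T(2)[of n], of "r ^ n"] r by (simp add: norm_mult norm_power)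
      thus "\<exists>N. \<forall>n\<ge>N. norm (fps_nth T n * of_real r ^ n) \<le> r ^ n" by blast
      show "summable (\<lambda>n. r ^ n)"
        using r by (intro summable_geometric) auto
    qed
  qed
  have "eval_fps T has_fps_expansion T"
    by (rule eval_fps_has_fps_expansion) (use radius in \<open>auto intro: less_le_trans[of _ 1]\<close>)
  hence "(\<lambda>z. g z * (exp \<circ> eval_fps T) z) has_fps_expansion A * (fps_exp 1 oo T)"
    by (intro has_fps_expansion_mult A has_fps_expansion_compose has_fps_expansion_exp1 T(1))
  moreover have "unit_disk \<subseteq> eball 0 (fps_conv_radius T)"
    using radius by (rule unit_disk_subset_eball)
  ultimately show ?thesis
    using T(1,3) by (intro that[of "eval_fps T"] holomorphic_on_eval_fps) (auto simp: eval_fps_at_0)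
qed

lemma restrict_in_RR:
  assumes "u holomorphic_on unit_disk" "u has_fps_expansion U" "\<And>n. fps_nth U n \<in> \<int>"
  shows "restrict u unit_disk \<in> carrier RR"
proof -
  have "eventually (\<lambda>z. u z = restrict u unit_disk z) (nhds 0)"
    using eventually_nhds_in_open[of unit_disk 0] by (auto elim: eventually_mono)
  hence "restrict u unit_disk has_fps_expansion U"
    using assms(2) has_fps_expansion_cong by blast
  hence "taylor_coeff (restrict u unit_disk) n = fps_nth U n" for n
    by (simp add: taylor_coeff_def fps_nth_fps_expansion)
  moreover have "restrict u unit_disk holomorphic_on unit_disk"
    using assms(1) by (rule holomorphic_transform) simp
  ultimately show ?thesis
    using assms(3) by (simp add: RR_def)
qed

lemma RR_holomorphic: "h \<in> carrier RR \<Longrightarrow> h holomorphic_on unit_disk"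
  by (simp add: RR_def)

lemma RR_expansion:
  assumes "h \<in> carrier RR"
  shows "h has_fps_expansion fps_expansion h 0" "fps_nth (fps_expansion h 0) n \<in> \<int>"
  using assms
  by (auto simp: RR_def taylor_coeff_def fps_expansion_def[of h]
           intro: has_fps_expansion_fps_expansion[of unit_disk, unfolded fps_expansion_def])

text \<open>The series of \<open>(u - 1) / z\<close> is the shifted series of \<open>u\<close>, with the same radius of convergence.\<close>
lemma one_plus_z_if_integral_coeffs:
  assumes hol: "u holomorphic_on unit_disk" and u0: "u 0 = 1"
    and U: "u has_fps_expansion U" "\<And>n. fps_nth U n \<in> \<int>"
  obtains H where "H \<in> carrier RR" "restrict u unit_disk = one_plus_z H"
proof
  define G where "G = eval_fps (fps_shift 1 U)"
  have radius: "fps_conv_radius U \<ge> 1"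
    using U(1) hol by (intro holomorphic_on_imp_fps_conv_radius_ge) auto
  have U0: "fps_nth U 0 = 1"
    using U(1) u0 by (simp add: fps_nth_fps_expansion)
  show "restrict G unit_disk \<in> carrier RR"
  proof (rule restrict_in_RR)
    show "G holomorphic_on unit_disk"
      unfolding G_def using radius
      by (intro holomorphic_on_eval_fps) (simp add: unit_disk_subset_eball)
    show "G has_fps_expansion fps_shift 1 U"
      unfolding G_def using radius
      by (intro eval_fps_has_fps_expansion) (auto intro: less_le_trans[of _ 1])
  qed (use U(2) in auto)
  have "u z = 1 + z * G z" if z: "z \<in> unit_disk" for z
  proof -
    have "(\<lambda>n. fps_nth U n * z ^ n) sums u z"
      using U(1) hol z by (intro has_fps_expansion_imp_sums_complex[where r = 1]) auto
    hence "(\<lambda>n. fps_nth U (Suc n) * z ^ Suc n) sums (u z - 1)"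
      by (subst sums_Suc_iff) (simp add: U0)
    hence "(\<lambda>n. z * (fps_nth (fps_shift 1 U) n * z ^ n)) sums (u z - 1)"
      by (simp add: mult_ac)
    moreover have "(\<lambda>n. fps_nth (fps_shift 1 U) n * z ^ n) sums G z"
      unfolding G_def using unit_disk_subset_eball[OF radius] z
      by (intro sums_eval_fps) (auto simp: in_eball_iff)
    hence "(\<lambda>n. z * (fps_nth (fps_shift 1 U) n * z ^ n)) sums (z * G z)"
      by (rule sums_mult)
    ultimately show ?thesis
      using sums_unique2 by fastforce
  qed
  thus "restrict u unit_disk = one_plus_z (restrict G unit_disk)"
    by (auto simp: one_plus_z_def restrict_def fun_eq_iff)
qed


section \<open>Splitting the divisor inside the ring\<close>

lemma zero_divisor_of_restrict:
  assumes "\<And>z. z \<in> unit_disk \<Longrightarrow> zorder u z = int (D z)" "divisor_support D \<subseteq> unit_disk"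
  shows "zero_divisor_of (restrict u unit_disk) = D"
proof
  fix z
  show "zero_divisor_of (restrict u unit_disk) z = D z"
  proof (cases "z \<in> unit_disk")
    case True
    have "eventually (\<lambda>w. restrict u unit_disk w = u w) (at z)"
      using eventually_at_in_open'[of unit_disk z] True by (auto elim: eventually_mono)
    hence "zorder (restrict u unit_disk) z = zorder u z"
      by (rule zorder_cong) simp
    thus ?thesis
      using True assms(1) by (simp add: zero_divisor_of_def)
  next
    case False
    thus ?thesis
      using assms(2) by (auto simp: zero_divisor_of_def divisor_support_def)
  qed
qed

theorem proposition5p7:
  fixes P :: "(complex \<Rightarrow> complex) set"
    and f F :: "complex \<Rightarrow> complex"
    and Z Z1 Z2 :: "complex \<Rightarrow> nat"
  assumes "P \<in> PP1"
    and "F \<in> carrier RR" and "f = one_plus_z F" and "f \<in> P"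
    and "Z = zero_divisor_of f"
    and "divisor_partition Z Z1 Z2"
    and "conj_invariant Z1"
  shows "Z1 \<in> FF Z P \<or> Z2 \<in> FF Z P"
proof -
  interpret primeideal P RR
    using assms(1) by (simp add: PP1_def)
  have f_RR: "f \<in> carrier RR"
    using assms(4) a_subset by blast
  have f_hol: "f holomorphic_on unit_disk"
    using f_RR by (rule RR_holomorphic)
  have f0: "f 0 = 1"
    by (simp add: assms(3) one_plus_z_def)
  have eff: "effective_divisor Z1" "effective_divisor Z2" and Z: "\<And>z. Z z = Z1 z + Z2 z"
    using assms(6) by (auto simp: divisor_partition_def)
  have support: "divisor_support Z1 \<subseteq> unit_disk" "divisor_support Z2 \<subseteq> unit_disk"
    using eff by (auto simp: effective_divisor_def)

  have f_nz: "frequently (\<lambda>w. f w \<noteq> 0) (at z)" and f_ana: "f analytic_on {z}"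
    if z: "z \<in> unit_disk" for z
  proof -
    show "f analytic_on {z}"
      using f_hol z analytic_at by blast
    have "eventually (\<lambda>w. f w \<noteq> 0 \<and> w \<in> unit_disk) (at z)"
      by (rule non_zero_neighbour_alt[OF f_hol, of z 0]) (use z f0 in auto)
    thus "frequently (\<lambda>w. f w \<noteq> 0) (at z)"
      by (intro eventually_frequently) (auto elim: eventually_mono)
  qed
  have f_ord: "zorder f z = int (Z z)" and f_zero: "f z = 0 \<longleftrightarrow> Z z \<noteq> 0" if "z \<in> unit_disk" for z
  proof -
    show "zorder f z = int (Z z)"
      using zorder_ge_0[OF f_ana f_nz] that by (simp add: assms(5) zero_divisor_of_def)
    thus "f z = 0 \<longleftrightarrow> Z z \<noteq> 0"
      using zorder_eq_0_iff[OF f_ana[OF that] f_nz[OF that]] by auto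
  qed
  have "Z 0 = 0"
    using f_zero[of 0] f0 by simp
  hence Z_0: "Z1 0 = 0" "Z2 0 = 0"
    using Z by auto

  obtain g1 where g1: "g1 holomorphic_on unit_disk" "g1 0 = 1"
    "\<And>z. z \<in> unit_disk \<Longrightarrow> g1 z = 0 \<longleftrightarrow> Z1 z \<noteq> 0"
    "\<And>z. z \<in> unit_disk \<Longrightarrow> zorder g1 z = int (Z1 z)"
    "\<And>z. z \<in> unit_disk \<Longrightarrow> g1 (cnj z) = cnj (g1 z)"
    using disk_function_with_divisor[OF eff(1) Z_0(1)] assms(7) by metis
  obtain g2 where g2: "g2 holomorphic_on unit_disk" "g2 0 = 1"
    "\<And>z. z \<in> unit_disk \<Longrightarrow> g2 z = 0 \<longleftrightarrow> Z2 z \<noteq> 0"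
    "\<And>z. z \<in> unit_disk \<Longrightarrow> zorder g2 z = int (Z2 z)"
    using disk_function_with_divisor[OF eff(2) Z_0(2)] by metis
  obtain q U1 where q: "q holomorphic_on unit_disk" "q 0 = 0"
    and U1: "(\<lambda>z. g1 z * exp (q z)) has_fps_expansion U1" "\<And>n. fps_nth U1 n \<in> \<int>"
    using integral_coeffs_after_exp_twist[OF g1(1,2,5)] by metis

  have ana: "h analytic_on {z}" if "h holomorphic_on unit_disk" "z \<in> unit_disk" for h z
    using that analytic_at by blast
  have nz: "eventually (\<lambda>w. g1 w \<noteq> 0 \<and> g2 w \<noteq> 0) (at z)" if z: "z \<in> unit_disk" for z
  proof -
    have "eventually (\<lambda>w. g1 w \<noteq> 0 \<and> w \<in> unit_disk) (at z)"
      by (rule non_zero_neighbour_alt[OF g1(1), of z 0]) (use z g1(2) in auto)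
    moreover have "eventually (\<lambda>w. g2 w \<noteq> 0 \<and> w \<in> unit_disk) (at z)"
      by (rule non_zero_neighbour_alt[OF g2(1), of z 0]) (use z g2(2) in auto)
    ultimately show ?thesis
      by eventually_elim auto
  qed

  define u1 where "u1 = (\<lambda>z. g1 z * exp (q z))"
  have u1_hol: "u1 holomorphic_on unit_disk"
    unfolding u1_def by (intro holomorphic_intros g1(1) q(1))
  have u1_0: "u1 0 = 1"
    by (simp add: u1_def g1(2) q(2))
  have u1_ord: "zorder u1 z = int (Z1 z)" if z: "z \<in> unit_disk" for z
  proof -
    have exp_ana: "(\<lambda>z. exp (q z)) analytic_on {z}"
      using ana[OF q(1) z] by (intro analytic_intros)
    have "zorder u1 z = zorder g1 z + zorder (\<lambda>z. exp (q z)) z"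
      unfolding u1_def
      by (intro zorder_times_analytic ana[OF g1(1) z] exp_ana eventually_mono[OF nz[OF z]]) auto
    thus ?thesis
      using zorder_eq_0I[OF exp_ana] g1(4)[OF z] by simp
  qed

  \<comment> \<open>The quotient by \<open>u1\<close> is obtained as \<open>v * g2\<close>, where \<open>v\<close> is the zero-free quotient of two
    functions with the same divisor.\<close>
  obtain v where v: "v holomorphic_on unit_disk" "\<And>z. z \<in> unit_disk \<Longrightarrow> v z \<noteq> 0"
    "\<And>z. z \<in> unit_disk \<Longrightarrow> f z = v z * (u1 z * g2 z)"
  proof (rule holomorphic_zorder_factorization[OF f_hol, of "\<lambda>z. u1 z * g2 z"])
    show "(\<lambda>z. u1 z * g2 z) holomorphic_on unit_disk"
      by (intro holomorphic_intros u1_hol g2(1))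
    show "u1 z * g2 z = 0 \<longleftrightarrow> f z = 0" if "z \<in> unit_disk" for z
      using that by (simp add: u1_def g1(3) g2(3) f_zero Z)
    show "zorder (\<lambda>z. u1 z * g2 z) z = zorder f z" if z: "z \<in> unit_disk" for z
    proof -
      have "zorder (\<lambda>z. u1 z * g2 z) z = zorder u1 z + zorder g2 z"
        by (intro zorder_times_analytic ana u1_hol g2(1) z eventually_mono[OF nz[OF z]])
           (auto simp: u1_def)
      thus ?thesis
        using z by (simp add: u1_ord g2(4) f_ord Z)
    qed
  qed auto

  define u2 where "u2 = (\<lambda>z. v z * g2 z)"
  have u2_hol: "u2 holomorphic_on unit_disk"
    unfolding u2_def by (intro holomorphic_intros v(1) g2(1))
  have f_eq: "f z = u1 z * u2 z" if "z \<in> unit_disk" for z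
    using v(3)[OF that] by (simp add: u2_def)
  have u2_0: "u2 0 = 1"
    using f_eq[of 0] f0 u1_0 by simp
  have u2_ord: "zorder u2 z = int (Z2 z)" if z: "z \<in> unit_disk" for z
  proof -
    have "eventually (\<lambda>w. w \<in> unit_disk) (at z)"
      using z by (intro eventually_at_in_open') auto
    hence "eventually (\<lambda>w. v w * g2 w \<noteq> 0) (at z)"
      using nz[OF z] by eventually_elim (use v(2) in auto)
    hence "zorder u2 z = zorder v z + zorder g2 z"
      unfolding u2_def by (intro zorder_times_analytic ana v(1) g2(1) z)
    thus ?thesis
      using zorder_eq_0I[OF ana[OF v(1) z] v(2)[OF z]] g2(4)[OF z] by simp
  qed

  define U2 where "U2 = fps_expansion u2 0"
  have U2: "u2 has_fps_expansion U2"
    unfolding U2_def using u2_hol by (intro has_fps_expansion_fps_expansion[of unit_disk]) auto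
  have "f has_fps_expansion U1 * U2"
  proof -
    have "eventually (\<lambda>z. f z = u1 z * u2 z) (nhds 0)"
      using eventually_nhds_in_open[of unit_disk 0] f_eq by (auto elim: eventually_mono)
    moreover have "(\<lambda>z. u1 z * u2 z) has_fps_expansion U1 * U2"
      using U1(1) U2 unfolding u1_def by (rule has_fps_expansion_mult)
    ultimately show ?thesis
      using has_fps_expansion_cong[of f "\<lambda>z. u1 z * u2 z" "U1 * U2" "U1 * U2"] by simp
  qed
  hence prod: "fps_expansion f 0 = U1 * U2"
    by (rule fps_expansion_eqI)
  have "fps_nth U1 0 = 1"
    using fps_nth_fps_expansion[OF U1(1), of 0] u1_0 by (simp add: u1_def)
  hence U2_int: "fps_nth U2 n \<in> \<int>" for n
    by (intro fps_factor_coeffs_closed[OF _ _ _ RR_expansion(2)[OF f_RR] U1(2) _ prod]) auto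

  define h1 where "h1 = restrict u1 unit_disk"
  define h2 where "h2 = restrict u2 unit_disk"
  have U1': "u1 has_fps_expansion U1"
    using U1(1) by (simp add: u1_def)
  have RR: "h1 \<in> carrier RR" "h2 \<in> carrier RR"
    unfolding h1_def h2_def
    using restrict_in_RR[OF u1_hol U1' U1(2)] restrict_in_RR[OF u2_hol U2 U2_int] by auto
  have form: "\<exists>H\<in>carrier RR. h1 = one_plus_z H" "\<exists>H\<in>carrier RR. h2 = one_plus_z H"
    unfolding h1_def h2_def
    using one_plus_z_if_integral_coeffs[OF u1_hol u1_0 U1' U1(2)]
      one_plus_z_if_integral_coeffs[OF u2_hol u2_0 U2 U2_int] by metis+
  have div: "zero_divisor_of h1 = Z1" "zero_divisor_of h2 = Z2"
    unfolding h1_def h2_def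
    using zero_divisor_of_restrict[OF u1_ord support(1)] zero_divisor_of_restrict[OF u2_ord support(2)]
    by auto
  have "f = h1 \<otimes>\<^bsub>RR\<^esub> h2"
    using f_RR f_eq by (auto simp: RR_def h1_def h2_def extensional_def fun_eq_iff restrict_def)
  hence "h1 \<in> P \<or> h2 \<in> P"
    using I_prime[OF RR] assms(4) by simp
  thus ?thesis
    using form div Z unfolding FF_def by fastforce
qed

end
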